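(* Let $\mathit{Atm}_0$ be infinite. Then the logic $\mathsf{D\text{-}WPLC}$ is sound and complete relative to the class $\mathbf{MCM}$: a formula of $\mathcal{L}^{\mathit{dyn}}$ is a theorem of $\mathsf{D\text{-}WPLC}$ if and only if it is valid in every multi-classifier model.
   Context: Let $\mathit{Atm}_0$ be a countable set of atomic propositions and $\mathit{Val}$ a finite set of output values; decision atoms $\mathsf{t}(x)$ for $x\in\mathit{Val}$. Language $\mathcal{L}^{\mathit{dyn}}$: $\varphi ::= p \mid \mathsf{t}(x)\mid \neg\varphi\mid \varphi\wedge\varphi\mid \Box_{\mathtt{I}}\varphi\mid \Box_{\mathtt{F}}\varphi\mid[\varphi]\psi$ ($p\in\mathit{Atm}_0$, $x\in\mathit{Val}$). A multi-classifier model (MCM) is a pair $\Gamma=(S,\Phi)$ with $S\subseteq 2^{\mathit{Atm}_0}$ and $\Phi$ a set of functions from $S$ to $\mathit{Val}$. For $s\in S$, $f\in\Phi$: $(\Gamma,s,f)\models p$ iff $p\in s$; $(\Gamma,s,f)\models\mathsf{t}(x)$ iff $f(s)=x$; Boolean connectives as usual; $(\Gamma,s,f)\models\Box_{\mathtt{I}}\varphi$ iff $(\Gamma,s',f)\models\varphi$ for all $s'\in S$; $(\Gamma,s,f)\models\Box_{\mathtt{F}}\varphi$ iff $(\Gamma,s,f')\models\varphi$ for all $f'\in\Phi$; $(\Gamma,s,f)\models[\varphi]\psi$ iff, if $(\Gamma,s,f)\models\Box_{\mathtt{I}}\varphi$ then $(\Gamma^\varphi,s,f)\models\psi$, where $\Gamma^\varphi=(S,\Phi^\varphi)$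 with $\Phi^\varphi=\{f'\in\Phi:\forall s'\in S,\ (\Gamma,s',f')\models\varphi\}$. The logic $\mathsf{WPLC}$ is classical propositional logic plus, with $\blacksquare\in\{\Box_{\mathtt{I}},\Box_{\mathtt{F}}\}$: K: $(\blacksquare\varphi\wedge\blacksquare(\varphi\to\psi))\to\blacksquare\psi$; T: $\blacksquare\varphi\to\varphi$; 4: $\blacksquare\varphi\to\blacksquare\blacksquare\varphi$; 5: $\neg\blacksquare\varphi\to\blacksquare\neg\blacksquare\varphi$; Comm: $\Box_{\mathtt{F}}\Box_{\mathtt{I}}\varphi\leftrightarrow\Box_{\mathtt{I}}\Box_{\mathtt{F}}\varphi$; AtLeast: $\bigvee_{x\in\mathit{Val}}\mathsf{t}(x)$; AtMost: $\mathsf{t}(x)\to\neg\mathsf{t}(y)$ for $x\neq y$; Indep: $p\to\Box_{\mathtt{F}}p$, $\neg p\to\Box_{\mathtt{F}}\neg p$ for $p\in\mathit{Atm}_0$; Nec: from $\varphi$ infer $\blacksquare\varphi$. The logic $\mathsf{D\text{-}WPLC}$ extends $\mathsf{WPLC}$ (over $\mathcal{L}^{\mathit{dyn}}$) by the reduction axioms $[\varphi]p\leftrightarrow(\Box_{\mathtt{I}}\varphi\to p)$; $[\varphi]\mathsf{t}(x)\leftrightarrow(\Box_{\mathtt{I}}\varphi\to\mathsf{t}(x))$; $[\varphi]\neg\psi\leftrightarrow(\Box_{\mathtt{I}}\varphi\to\neg[\varphi]\psi)$; $[\varphi](\psi_1\wedge\psi_2)\leftrightarrow([\varphi]\psi_1\wedge[\varphi]\psi_2)$;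 $[\varphi]\Box_{\mathtt{I}}\psi\leftrightarrow(\Box_{\mathtt{I}}\varphi\to\Box_{\mathtt{I}}[\varphi]\psi)$; $[\varphi]\Box_{\mathtt{F}}\psi\leftrightarrow(\Box_{\mathtt{I}}\varphi\to\Box_{\mathtt{F}}[\varphi]\psi)$, and the rule of replacement of equivalents: from $\varphi_1\leftrightarrow\varphi_2$ infer $\psi\leftrightarrow\psi[\varphi_1/\varphi_2]$. *)

theory Defs
  imports Main "HOL-Library.Countable" "HOL-Library.FuncSet"
begin

text \<open>
  The set of atomic propositions is the type \<open>'p\<close> and the finite set of output values
  is the type \<open>'v\<close>.  Negation, conjunction, the two boxes and the announcement operator
  \<open>[\<phi>]\<psi>\<close>, written \<open>Ann \<phi> \<psi>\<close>, are primitive.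
\<close>

datatype ('p, 'v) fm =
    Atm 'p
  | Dec 'v
  | Neg "('p, 'v) fm"
  | And "('p, 'v) fm" "('p, 'v) fm"
  | BoxI "('p, 'v) fm"
  | BoxF "('p, 'v) fm"
  | Ann "('p, 'v) fm" "('p, 'v) fm"

definition Or :: "('p, 'v) fm \<Rightarrow> ('p, 'v) fm \<Rightarrow> ('p, 'v) fm" where
  "Or \<phi> \<psi> = Neg (And (Neg \<phi>) (Neg \<psi>))"

definition Imp :: "('p, 'v) fm \<Rightarrow> ('p, 'v) fm \<Rightarrow> ('p, 'v) fm" where
  "Imp \<phi> \<psi> = Neg (And \<phi> (Neg \<psi>))"

definition Iff :: "('p, 'v) fm \<Rightarrow> ('p, 'v) fm \<Rightarrow> ('p, 'v) fm" where
  "Iff \<phi> \<psi> = And (Imp \<phi> \<psi>) (Imp \<psi> \<phi>)"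

text \<open>The disjunction of the nonempty list \<open>\<phi> # \<phi>s\<close>.\<close>

fun BigOr :: "('p, 'v) fm \<Rightarrow> ('p, 'v) fm list \<Rightarrow> ('p, 'v) fm" where
  "BigOr \<phi> [] = \<phi>"
| "BigOr \<phi> (\<psi> # \<psi>s) = Or \<phi> (BigOr \<psi> \<psi>s)"


section \<open>Semantics\<close>

type_synonym ('p, 'v) mcm = "'p set set \<times> ('p set \<Rightarrow> 'v) set"

text \<open>
  A function with domain \<open>S\<close> is an element of \<open>S \<rightarrow>\<^sub>E UNIV\<close>: it takes the value
  \<open>undefined\<close> outside \<open>S\<close>, so that it is determined by its values on \<open>S\<close>.
\<close>

definition is_mcm :: "('p, 'v) mcm \<Rightarrow> bool" where
  "is_mcm \<Gamma> \<longleftrightarrow> snd \<Gamma> \<subseteq> (fst \<Gamma> \<rightarrow>\<^sub>E UNIV)"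

text \<open>The updated model, for a formula whose truth set is given by the predicate \<open>P\<close>.\<close>

definition update ::
  "('p, 'v) mcm \<Rightarrow> ('p set \<Rightarrow> ('p set \<Rightarrow> 'v) \<Rightarrow> bool) \<Rightarrow> ('p, 'v) mcm" where
  "update \<Gamma> P = (fst \<Gamma>, {f' \<in> snd \<Gamma>. \<forall>s'\<in>fst \<Gamma>. P s' f'})"

text \<open>The premise in the clause for \<open>Ann\<close> is the truth condition of \<open>BoxI \<phi>\<close>.\<close>

primrec sat :: "('p, 'v) mcm \<Rightarrow> 'p set \<Rightarrow> ('p set \<Rightarrow> 'v) \<Rightarrow> ('p, 'v) fm \<Rightarrow> bool" where
  "sat \<Gamma> s f (Atm p) \<longleftrightarrow> p \<in> s"
| "sat \<Gamma> s f (Dec x) \<longleftrightarrow> f s = x"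
| "sat \<Gamma> s f (Neg \<phi>) \<longleftrightarrow> \<not> sat \<Gamma> s f \<phi>"
| "sat \<Gamma> s f (And \<phi> \<psi>) \<longleftrightarrow> sat \<Gamma> s f \<phi> \<and> sat \<Gamma> s f \<psi>"
| "sat \<Gamma> s f (BoxI \<phi>) \<longleftrightarrow> (\<forall>s'\<in>fst \<Gamma>. sat \<Gamma> s' f \<phi>)"
| "sat \<Gamma> s f (BoxF \<phi>) \<longleftrightarrow> (\<forall>f'\<in>snd \<Gamma>. sat \<Gamma> s f' \<phi>)"
| "sat \<Gamma> s f (Ann \<phi> \<psi>) \<longleftrightarrow>
     ((\<forall>s'\<in>fst \<Gamma>. sat \<Gamma> s' f \<phi>) \<longrightarrow>
      sat (update \<Gamma> (\<lambda>s' f'. sat \<Gamma> s' f' \<phi>)) s f \<psi>)"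

definition mcm_valid :: "('p, 'v) fm \<Rightarrow> bool" where
  "mcm_valid \<phi> \<longleftrightarrow>
     (\<forall>\<Gamma>. is_mcm \<Gamma> \<longrightarrow> (\<forall>s\<in>fst \<Gamma>. \<forall>f\<in>snd \<Gamma>. sat \<Gamma> s f \<phi>))"


section \<open>Axiomatics\<close>

text \<open>
  Classical propositional logic is given by all instances of tautologies together with
  modus ponens.  An instance of a tautology is a formula that is true under every
  assignment of truth values to its subformulas whose main operator is not Boolean.
\<close>

primrec peval :: "(('p, 'v) fm \<Rightarrow> bool) \<Rightarrow> ('p, 'v) fm \<Rightarrow> bool" where
  "peval v (Atm p) \<longleftrightarrow> v (Atm p)"
| "peval v (Dec x) \<longleftrightarrow> v (Dec x)"
| "peval v (Neg \<phi>) \<longleftrightarrow> \<not> peval v \<phi>"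
| "peval v (And \<phi> \<psi>) \<longleftrightarrow> peval v \<phi> \<and> peval v \<psi>"
| "peval v (BoxI \<phi>) \<longleftrightarrow> v (BoxI \<phi>)"
| "peval v (BoxF \<phi>) \<longleftrightarrow> v (BoxF \<phi>)"
| "peval v (Ann \<phi> \<psi>) \<longleftrightarrow> v (Ann \<phi> \<psi>)"

definition tautology :: "('p, 'v) fm \<Rightarrow> bool" where
  "tautology \<phi> \<longleftrightarrow> (\<forall>v. peval v \<phi>)"

text \<open>
  In \<open>AtLeast\<close> the list \<open>x # xs\<close> is an arbitrary enumeration of the output values,
  since the order of the disjuncts is immaterial.
\<close>

inductive wplc_axiom :: "('p, 'v) fm \<Rightarrow> bool" where
  Taut: "tautology \<phi> \<Longrightarrow> wplc_axiom \<phi>"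
| K: "B \<in> {BoxI, BoxF} \<Longrightarrow> wplc_axiom (Imp (And (B \<phi>) (B (Imp \<phi> \<psi>))) (B \<psi>))"
| T: "B \<in> {BoxI, BoxF} \<Longrightarrow> wplc_axiom (Imp (B \<phi>) \<phi>)"
| Four: "B \<in> {BoxI, BoxF} \<Longrightarrow> wplc_axiom (Imp (B \<phi>) (B (B \<phi>)))"
| Five: "B \<in> {BoxI, BoxF} \<Longrightarrow> wplc_axiom (Imp (Neg (B \<phi>)) (B (Neg (B \<phi>))))"
| Comm: "wplc_axiom (Iff (BoxF (BoxI \<phi>)) (BoxI (BoxF \<phi>)))"
| AtLeast: "distinct (x # xs) \<Longrightarrow> set (x # xs) = UNIV \<Longrightarrow>
    wplc_axiom (BigOr (Dec x) (map Dec xs))"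
| AtMost: "x \<noteq> y \<Longrightarrow> wplc_axiom (Imp (Dec x) (Neg (Dec y)))"
| Indep_pos: "wplc_axiom (Imp (Atm p) (BoxF (Atm p)))"
| Indep_neg: "wplc_axiom (Imp (Neg (Atm p)) (BoxF (Neg (Atm p))))"

inductive reduction_axiom :: "('p, 'v) fm \<Rightarrow> bool" where
  Red_Atm: "reduction_axiom (Iff (Ann \<phi> (Atm p)) (Imp (BoxI \<phi>) (Atm p)))"
| Red_Dec: "reduction_axiom (Iff (Ann \<phi> (Dec x)) (Imp (BoxI \<phi>) (Dec x)))"
| Red_Neg: "reduction_axiom (Iff (Ann \<phi> (Neg \<psi>)) (Imp (BoxI \<phi>) (Neg (Ann \<phi> \<psi>))))"
| Red_And: "reduction_axiom
    (Iff (Ann \<phi> (And \<psi>\<^sub>1 \<psi>\<^sub>2)) (And (Ann \<phi> \<psi>\<^sub>1) (Ann \<phi> \<psi>\<^sub>2)))"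
| Red_BoxI: "reduction_axiom
    (Iff (Ann \<phi> (BoxI \<psi>)) (Imp (BoxI \<phi>) (BoxI (Ann \<phi> \<psi>))))"
| Red_BoxF: "reduction_axiom
    (Iff (Ann \<phi> (BoxF \<psi>)) (Imp (BoxI \<phi>) (BoxF (Ann \<phi> \<psi>))))"

text \<open>
  \<open>replaced \<alpha> \<beta> \<psi> \<psi>'\<close> says that \<open>\<psi>'\<close> results from \<open>\<psi>\<close> by replacing zero or more
  occurrences of \<open>\<alpha>\<close> by \<open>\<beta>\<close>.
\<close>

inductive replaced ::
  "('p, 'v) fm \<Rightarrow> ('p, 'v) fm \<Rightarrow> ('p, 'v) fm \<Rightarrow> ('p, 'v) fm \<Rightarrow> bool"
  for \<alpha> \<beta> where
  same: "replaced \<alpha> \<beta> \<psi> \<psi>"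
| here: "replaced \<alpha> \<beta> \<alpha> \<beta>"
| Neg: "replaced \<alpha> \<beta> \<psi> \<psi>' \<Longrightarrow> replaced \<alpha> \<beta> (Neg \<psi>) (Neg \<psi>')"
| And: "replaced \<alpha> \<beta> \<psi> \<psi>' \<Longrightarrow> replaced \<alpha> \<beta> \<chi> \<chi>' \<Longrightarrow>
    replaced \<alpha> \<beta> (And \<psi> \<chi>) (And \<psi>' \<chi>')"
| BoxI: "replaced \<alpha> \<beta> \<psi> \<psi>' \<Longrightarrow> replaced \<alpha> \<beta> (BoxI \<psi>) (BoxI \<psi>')"
| BoxF: "replaced \<alpha> \<beta> \<psi> \<psi>' \<Longrightarrow> replaced \<alpha> \<beta> (BoxF \<psi>) (BoxF \<psi>')"
| Ann: "replaced \<alpha> \<beta> \<psi> \<psi>' \<Longrightarrow> replaced \<alpha> \<beta> \<chi> \<chi>' \<Longrightarrow>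
    replaced \<alpha> \<beta> (Ann \<psi> \<chi>) (Ann \<psi>' \<chi>')"

inductive dwplc :: "('p, 'v) fm \<Rightarrow> bool" where
  WPLC: "wplc_axiom \<phi> \<Longrightarrow> dwplc \<phi>"
| Reduction: "reduction_axiom \<phi> \<Longrightarrow> dwplc \<phi>"
| MP: "dwplc (Imp \<phi> \<psi>) \<Longrightarrow> dwplc \<phi> \<Longrightarrow> dwplc \<psi>"
| Nec: "B \<in> {BoxI, BoxF} \<Longrightarrow> dwplc \<phi> \<Longrightarrow> dwplc (B \<phi>)"
| RE: "dwplc (Iff \<phi>\<^sub>1 \<phi>\<^sub>2) \<Longrightarrow> replaced \<phi>\<^sub>1 \<phi>\<^sub>2 \<psi> \<psi>' \<Longrightarrow> dwplc (Iff \<psi> \<psi>')"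

end

theory Submission
  imports Defs
begin

text \<open>
  The reduction axioms make every formula provably equivalent to one without announcements, so
  completeness only concerns the static fragment.  There the canonical accessibility relations
  are equivalence relations that commute, and the model has to be unravelled into a product of
  a set of states and a set of functions.  If every nonempty cell
  (the worlds \<open>w\<close> with \<open>i R\<^sub>F w R\<^sub>I j\<close>) is the image of one fixed group \<open>G\<close>, say under
  \<open>g\<^sub>i\<^sub>j\<close>, then \<open>((i, a), (j, b)) \<mapsto> g\<^sub>i\<^sub>j (a + b)\<close> is a bounded morphism from such a product onto
  the canonical component: fixing one coordinate, the other one can be solved for.  Sets of
  formulas under symmetric difference serve as \<open>G\<close>.  There are at most continuum many rows
  \<open>(i, a)\<close>, so they can be made into distinct states by means of the infinitely many atoms that
  do not occur in the given formula.
\<close>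

section \<open>Soundness\<close>

lemmas connective_defs = Or_def Imp_def Iff_def

lemma sat_connectives [simp]:
  "sat \<Gamma> s f (Imp \<phi> \<psi>) \<longleftrightarrow> (sat \<Gamma> s f \<phi> \<longrightarrow> sat \<Gamma> s f \<psi>)"
  "sat \<Gamma> s f (Iff \<phi> \<psi>) \<longleftrightarrow> (sat \<Gamma> s f \<phi> \<longleftrightarrow> sat \<Gamma> s f \<psi>)"
  "sat \<Gamma> s f (Or \<phi> \<psi>) \<longleftrightarrow> sat \<Gamma> s f \<phi> \<or> sat \<Gamma> s f \<psi>"
  by (auto simp: connective_defs)

text \<open>Truth at a fixed point of a model is one of the assignments over which
  \<open>tautology\<close> quantifies.\<close>

lemma peval_sat: "peval (sat \<Gamma> s f) \<phi> \<longleftrightarrow> sat \<Gamma> s f \<phi>"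
  by (induction \<phi>) auto

lemma sat_tautology: "tautology \<phi> \<Longrightarrow> sat \<Gamma> s f \<phi>"
  by (metis tautology_def peval_sat)

lemma sat_BigOr: "sat \<Gamma> s f (BigOr \<phi> \<phi>s) \<longleftrightarrow> (\<exists>\<psi>\<in>set (\<phi> # \<phi>s). sat \<Gamma> s f \<psi>)"
  by (induction \<phi> \<phi>s rule: BigOr.induct) auto

lemma is_mcm_update: "is_mcm \<Gamma> \<Longrightarrow> is_mcm (update \<Gamma> P)"
  by (auto simp: is_mcm_def update_def)

lemma wplc_axiom_sound:
  assumes "wplc_axiom \<phi>" "s \<in> fst \<Gamma>" "f \<in> snd \<Gamma>"
  shows "sat \<Gamma> s f \<phi>"
  using assms
proof (induction rule: wplc_axiom.induct)
  case (AtLeast x xs)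
  then have "f s \<in> set (x # xs)" by simp
  then show ?case by (auto simp: sat_BigOr)
qed (auto simp: sat_tautology)

lemma reduction_axiom_sound:
  assumes "reduction_axiom \<phi>" "s \<in> fst \<Gamma>" "f \<in> snd \<Gamma>"
  shows "sat \<Gamma> s f \<phi>"
  using assms by (induction rule: reduction_axiom.induct) (auto simp: update_def)

text \<open>The induction generalizes over the model because the body of an announcement is
  evaluated in an updated model. Validity of the equivalence in all models carries it there.\<close>

lemma replaced_sound:
  assumes "replaced \<alpha> \<beta> \<psi> \<psi>'" "mcm_valid (Iff \<alpha> \<beta>)"
    and "is_mcm \<Gamma>" "s \<in> fst \<Gamma>" "f \<in> snd \<Gamma>"
  shows "sat \<Gamma> s f \<psi> \<longleftrightarrow> sat \<Gamma> s f \<psi>'"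
  using assms
proof (induction arbitrary: \<Gamma> s f rule: replaced.induct)
  case here
  then show ?case unfolding mcm_valid_def sat_connectives by blast
next
  case (Ann \<psi> \<psi>' \<chi> \<chi>')
  have eq: "sat \<Gamma> s' f' \<psi> \<longleftrightarrow> sat \<Gamma> s' f' \<psi>'" if "s' \<in> fst \<Gamma>" "f' \<in> snd \<Gamma>" for s' f'
    by (rule Ann.IH(1)) (use Ann.prems that in auto)
  then have upd: "update \<Gamma> (\<lambda>s' f'. sat \<Gamma> s' f' \<psi>) = update \<Gamma> (\<lambda>s' f'. sat \<Gamma> s' f' \<psi>')"
    by (auto simp: update_def)
  \<comment> \<open>The premise of the announcement is exactly what keeps \<open>f\<close> in the
    updated model, so the induction hypothesis for the body applies at \<open>s\<close> and
    \<open>f\<close>.\<close>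
  have "sat (update \<Gamma> (\<lambda>s' f'. sat \<Gamma> s' f' \<psi>')) s f \<chi>
      \<longleftrightarrow> sat (update \<Gamma> (\<lambda>s' f'. sat \<Gamma> s' f' \<psi>')) s f \<chi>'"
    if "\<forall>s'\<in>fst \<Gamma>. sat \<Gamma> s' f \<psi>'"
    using that Ann.prems by (intro Ann.IH(2) is_mcm_update) (auto simp: update_def)
  then show ?case using Ann.prems(4) by (simp add: upd eq)
qed auto

lemma dwplc_sound: "dwplc \<phi> \<Longrightarrow> mcm_valid \<phi>"
proof (induction rule: dwplc.induct)
  case (WPLC \<phi>)
  then show ?case by (auto simp: mcm_valid_def wplc_axiom_sound)
next
  case (Reduction \<phi>)
  then show ?case by (auto simp: mcm_valid_def reduction_axiom_sound)
next
  case (RE \<phi>\<^sub>1 \<phi>\<^sub>2 \<psi> \<psi>')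
  then show ?case using replaced_sound by (fastforce simp: mcm_valid_def)
qed (auto simp: mcm_valid_def)

section \<open>Elimination of announcements\<close>

primrec static :: "('p, 'v) fm \<Rightarrow> bool" where
  "static (Atm p) \<longleftrightarrow> True"
| "static (Dec x) \<longleftrightarrow> True"
| "static (Neg \<phi>) \<longleftrightarrow> static \<phi>"
| "static (And \<phi> \<psi>) \<longleftrightarrow> static \<phi> \<and> static \<psi>"
| "static (BoxI \<phi>) \<longleftrightarrow> static \<phi>"
| "static (BoxF \<phi>) \<longleftrightarrow> static \<phi>"
| "static (Ann \<phi> \<psi>) \<longleftrightarrow> False"

lemma static_Imp [simp]: "static (Imp \<phi> \<psi>) \<longleftrightarrow> static \<phi> \<and> static \<psi>"
  by (simp add: Imp_def)

section \<open>Propositional consequence inside the logic\<close>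

lemma peval_connectives [simp]:
  "peval v (Imp \<phi> \<psi>) \<longleftrightarrow> (peval v \<phi> \<longrightarrow> peval v \<psi>)"
  "peval v (Iff \<phi> \<psi>) \<longleftrightarrow> (peval v \<phi> \<longleftrightarrow> peval v \<psi>)"
  "peval v (Or \<phi> \<psi>) \<longleftrightarrow> peval v \<phi> \<or> peval v \<psi>"
  by (auto simp: connective_defs)

lemma dwplc_taut: "tautology \<phi> \<Longrightarrow> dwplc \<phi>"
  by (intro dwplc.WPLC wplc_axiom.Taut)

lemma dwplc_taut1: "dwplc \<phi> \<Longrightarrow> (\<And>v. peval v \<phi> \<Longrightarrow> peval v \<psi>) \<Longrightarrow> dwplc \<psi>"
  by (rule dwplc.MP[of \<phi>]) (auto intro!: dwplc_taut simp: tautology_def)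

lemma dwplc_taut2:
  assumes "dwplc \<phi>" "dwplc \<psi>" "\<And>v. peval v \<phi> \<Longrightarrow> peval v \<psi> \<Longrightarrow> peval v \<chi>"
  shows "dwplc \<chi>"
proof -
  have "dwplc (Imp \<phi> (Imp \<psi> \<chi>))"
    using assms(3) by (auto intro!: dwplc_taut simp: tautology_def)
  then show ?thesis using assms(1,2) dwplc.MP by blast
qed

section \<open>Provable equivalence as a congruence\<close>

lemma dwplc_Iff_refl: "dwplc (Iff \<phi> \<phi>)"
  by (rule dwplc_taut) (simp add: tautology_def)

lemma dwplc_Iff_trans: "dwplc (Iff \<phi> \<psi>) \<Longrightarrow> dwplc (Iff \<psi> \<chi>) \<Longrightarrow> dwplc (Iff \<phi> \<chi>)"
  by (erule (1) dwplc_taut2) auto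

lemma dwplc_Iff_BoxI: "dwplc (Iff \<phi> \<psi>) \<Longrightarrow> dwplc (Iff (BoxI \<phi>) (BoxI \<psi>))"
  by (erule dwplc.RE) (rule replaced.BoxI[OF replaced.here])

lemma dwplc_Iff_BoxF: "dwplc (Iff \<phi> \<psi>) \<Longrightarrow> dwplc (Iff (BoxF \<phi>) (BoxF \<psi>))"
  by (erule dwplc.RE) (rule replaced.BoxF[OF replaced.here])

lemma dwplc_Iff_Neg: "dwplc (Iff \<phi> \<psi>) \<Longrightarrow> dwplc (Iff (Neg \<phi>) (Neg \<psi>))"
  by (erule dwplc_taut1) simp

lemma dwplc_Iff_Imp: "dwplc (Iff \<phi> \<psi>) \<Longrightarrow> dwplc (Iff (Imp \<chi> \<phi>) (Imp \<chi> \<psi>))"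
  by (erule dwplc_taut1) simp

lemma dwplc_Iff_And:
  "dwplc (Iff \<phi> \<phi>') \<Longrightarrow> dwplc (Iff \<psi> \<psi>') \<Longrightarrow> dwplc (Iff (And \<phi> \<psi>) (And \<phi>' \<psi>'))"
  by (erule (1) dwplc_taut2) auto

lemma dwplc_Iff_Ann:
  assumes "dwplc (Iff \<phi> \<phi>')" "dwplc (Iff \<psi> \<psi>')"
  shows "dwplc (Iff (Ann \<phi> \<psi>) (Ann \<phi>' \<psi>'))"
proof -
  have "dwplc (Iff (Ann \<phi> \<psi>) (Ann \<phi>' \<psi>))" "dwplc (Iff (Ann \<phi>' \<psi>) (Ann \<phi>' \<psi>'))"
    by (rule dwplc.RE[OF assms(1)], rule replaced.Ann[OF replaced.here replaced.same],
        rule dwplc.RE[OF assms(2)], rule replaced.Ann[OF replaced.same replaced.here])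
  then show ?thesis by (rule dwplc_Iff_trans)
qed

text \<open>Each reduction axiom pushes the announcement below the main operator of \<psi>, until it
  disappears at an atom. The case of a nested announcement cannot arise, since \<psi> is
  static.\<close>

lemma Ann_static:
  assumes "static \<phi>" "static \<psi>"
  shows "\<exists>\<chi>. static \<chi> \<and> dwplc (Iff (Ann \<phi> \<psi>) \<chi>)"
  using assms(2)
proof (induction \<psi>)
  case (Atm p)
  show ?case using dwplc.Reduction[OF Red_Atm] assms(1)
    by (metis static.simps(1,5) static_Imp)
next
  case (Dec x)
  show ?case using dwplc.Reduction[OF Red_Dec] assms(1)
    by (metis static.simps(2,5) static_Imp)
next
  case (Neg \<psi>)
  then obtain \<chi> where "static \<chi>" and *: "dwplc (Iff (Ann \<phi> \<psi>) \<chi>)" by auto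
  moreover note dwplc_Iff_trans[OF dwplc.Reduction[OF Red_Neg] dwplc_Iff_Imp[OF dwplc_Iff_Neg[OF *]]]
  ultimately show ?case using assms(1) by (metis static.simps(3,5) static_Imp)
next
  case (And \<psi>1 \<psi>2)
  then obtain \<chi>1 \<chi>2 where "static \<chi>1" "static \<chi>2"
    and *: "dwplc (Iff (Ann \<phi> \<psi>1) \<chi>1)" "dwplc (Iff (Ann \<phi> \<psi>2) \<chi>2)" by auto
  moreover note dwplc_Iff_trans[OF dwplc.Reduction[OF Red_And] dwplc_Iff_And[OF *]]
  ultimately show ?case by (metis static.simps(4))
next
  case (BoxI \<psi>)
  then obtain \<chi> where "static \<chi>" and *: "dwplc (Iff (Ann \<phi> \<psi>) \<chi>)" by auto
  moreover note
    dwplc_Iff_trans[OF dwplc.Reduction[OF Red_BoxI] dwplc_Iff_Imp[OF dwplc_Iff_BoxI[OF *]]]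
  ultimately show ?case using assms(1) by (metis static.simps(5) static_Imp)
next
  case (BoxF \<psi>)
  then obtain \<chi> where "static \<chi>" and *: "dwplc (Iff (Ann \<phi> \<psi>) \<chi>)" by auto
  moreover note
    dwplc_Iff_trans[OF dwplc.Reduction[OF Red_BoxF] dwplc_Iff_Imp[OF dwplc_Iff_BoxF[OF *]]]
  ultimately show ?case using assms(1) by (metis static.simps(5,6) static_Imp)
qed simp

text \<open>Announcements are eliminated from the inside out: congruence first makes both arguments
  of \<open>Ann\<close> static, and then \<open>Ann_static\<close> removes the operator
  itself.\<close>

lemma equivalent_static: "\<exists>\<chi>. static \<chi> \<and> dwplc (Iff \<phi> \<chi>)"
proof (induction \<phi>)
  case (Atm p)
  show ?case by (rule exI[of _ "Atm p"]) (simp add: dwplc_Iff_refl)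
next
  case (Dec x)
  show ?case by (rule exI[of _ "Dec x"]) (simp add: dwplc_Iff_refl)
next
  case (Neg \<phi>)
  then obtain \<chi> where "static \<chi>" "dwplc (Iff \<phi> \<chi>)" by blast
  then show ?case by (intro exI[of _ "Neg \<chi>"]) (simp add: dwplc_Iff_Neg)
next
  case (And \<phi> \<psi>)
  then obtain \<chi> \<xi> where "static \<chi>" "dwplc (Iff \<phi> \<chi>)" "static \<xi>" "dwplc (Iff \<psi> \<xi>)" by blast
  then show ?case by (intro exI[of _ "And \<chi> \<xi>"]) (simp add: dwplc_Iff_And)
next
  case (BoxI \<phi>)
  then obtain \<chi> where "static \<chi>" "dwplc (Iff \<phi> \<chi>)" by blast
  then show ?case by (intro exI[of _ "BoxI \<chi>"]) (simp add: dwplc_Iff_BoxI)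
next
  case (BoxF \<phi>)
  then obtain \<chi> where "static \<chi>" "dwplc (Iff \<phi> \<chi>)" by blast
  then show ?case by (intro exI[of _ "BoxF \<chi>"]) (simp add: dwplc_Iff_BoxF)
next
  case (Ann \<phi> \<psi>)
  then obtain \<chi> \<xi> where *: "static \<chi>" "static \<xi>" "dwplc (Iff \<phi> \<chi>)" "dwplc (Iff \<psi> \<xi>)" by blast
  obtain \<zeta> where "static \<zeta>" "dwplc (Iff (Ann \<chi> \<xi>) \<zeta>)" using Ann_static[OF *(1,2)] by blast
  then show ?case using dwplc_Iff_trans[OF dwplc_Iff_Ann[OF *(3,4)]] by blast
qed

section \<open>Maximal consistent sets\<close>

text \<open>Necessitation enters only through theorems and is never applied to premises; this is
  what makes the deduction theorem hold.\<close>

inductive derives :: "('p, 'v) fm set \<Rightarrow> ('p, 'v) fm \<Rightarrow> bool" for \<Gamma> where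
  prem: "\<phi> \<in> \<Gamma> \<Longrightarrow> derives \<Gamma> \<phi>"
| provable: "dwplc \<phi> \<Longrightarrow> derives \<Gamma> \<phi>"
| mp: "derives \<Gamma> (Imp \<phi> \<psi>) \<Longrightarrow> derives \<Gamma> \<phi> \<Longrightarrow> derives \<Gamma> \<psi>"

lemma derives_taut: "(\<And>v. peval v \<phi>) \<Longrightarrow> derives \<Gamma> \<phi>"
  by (intro derives.provable dwplc_taut) (simp add: tautology_def)

lemma derives_taut1: "derives \<Gamma> \<phi> \<Longrightarrow> (\<And>v. peval v \<phi> \<Longrightarrow> peval v \<psi>) \<Longrightarrow> derives \<Gamma> \<psi>"
  by (rule derives.mp[of \<Gamma> \<phi>]) (auto intro!: derives_taut)

lemma derives_taut2:
  assumes "derives \<Gamma> \<phi>" "derives \<Gamma> \<psi>" "\<And>v. peval v \<phi> \<Longrightarrow> peval v \<psi> \<Longrightarrow> peval v \<chi>"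
  shows "derives \<Gamma> \<chi>"
proof -
  have "derives \<Gamma> (Imp \<phi> (Imp \<psi> \<chi>))"
    using assms(3) by (auto intro!: derives_taut)
  then show ?thesis using assms(1,2) derives.mp by blast
qed

lemma derives_mono: "derives \<Gamma> \<phi> \<Longrightarrow> \<Gamma> \<subseteq> \<Delta> \<Longrightarrow> derives \<Delta> \<phi>"
  by (induction rule: derives.induct) (auto intro: derives.intros)

lemma derives_empty: "derives {} \<phi> \<longleftrightarrow> dwplc \<phi>"
proof
  show "derives {} \<phi> \<Longrightarrow> dwplc \<phi>"
    by (induction rule: derives.induct) (auto intro: dwplc.MP)
qed (rule derives.provable)

lemma deduction: "derives (insert \<phi> \<Gamma>) \<psi> \<Longrightarrow> derives \<Gamma> (Imp \<phi> \<psi>)"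
proof (induction rule: derives.induct)
  case (prem \<psi>)
  show ?case
  proof (cases "\<psi> = \<phi>")
    case False
    with prem have "derives \<Gamma> \<psi>" by (auto intro: derives.prem)
    then show ?thesis by (rule derives_taut1) simp
  qed (auto intro: derives_taut)
next
  case (provable \<psi>)
  then show ?case by (intro derives_taut1[OF derives.provable]) auto
next
  case (mp \<psi> \<chi>)
  show ?case by (rule derives_taut2[OF mp.IH]) auto
qed

lemma derives_finite: "derives \<Gamma> \<phi> \<Longrightarrow> \<exists>F. finite F \<and> F \<subseteq> \<Gamma> \<and> derives F \<phi>"
proof (induction rule: derives.induct)
  case (prem \<phi>)
  then show ?case by (intro exI[of _ "{\<phi>}"]) (auto intro: derives.prem)
next
  case (provable \<phi>)
  then show ?case by (intro exI[of _ "{}"]) (auto intro: derives.provable)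
next
  case (mp \<phi> \<psi>)
  then obtain F G where "finite F" "F \<subseteq> \<Gamma>" "derives F (Imp \<phi> \<psi>)" "finite G" "G \<subseteq> \<Gamma>" "derives G \<phi>"
    by blast
  moreover from this have "derives (F \<union> G) \<psi>"
    by (meson derives.mp derives_mono sup_ge1 sup_ge2)
  ultimately show ?case by (meson finite_UnI Un_least)
qed

text \<open>A deductively closed \<open>B\<close> is closed under conjunction, so the premises taken
  from \<open>B\<close> in a derivation can be merged into a single one.\<close>

lemma derives_Un_closed:
  assumes "derives (A \<union> B) \<chi>" "\<And>\<beta>. derives B \<beta> \<Longrightarrow> \<beta> \<in> B"
  shows "\<exists>\<beta>\<in>B. derives A (Imp \<beta> \<chi>)"
  using assms(1)
proof (induction rule: derives.induct)
  case (prem \<chi>)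
  show ?case
  proof (cases "\<chi> \<in> B")
    case True
    then show ?thesis by (rule bexI[rotated]) (simp add: derives_taut)
  next
    case False
    \<comment> \<open>When no premise from \<open>B\<close> is used, the tautology
      \<open>Imp \<chi> \<chi>\<close> serves as the required element of \<open>B\<close>.\<close>
    with prem have "derives A (Imp (Imp \<chi> \<chi>) \<chi>)"
      by (intro derives_taut1[OF derives.prem]) auto
    then show ?thesis by (rule bexI) (rule assms(2), rule derives_taut, simp)
  qed
next
  case (provable \<chi>)
  then have "derives A (Imp (Imp \<chi> \<chi>) \<chi>)"
    by (intro derives_taut1[OF derives.provable]) auto
  then show ?case by (rule bexI) (rule assms(2), rule derives_taut, simp)
next
  case (mp \<phi> \<psi>)
  then obtain \<beta>1 \<beta>2 where \<beta>: "\<beta>1 \<in> B" "derives A (Imp \<beta>1 (Imp \<phi> \<psi>))" "\<beta>2 \<in> B" "derives A (Imp \<beta>2 \<phi>)"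
    by blast
  have "derives A (Imp (And \<beta>1 \<beta>2) \<psi>)"
    by (rule derives_taut2[OF \<beta>(2,4)]) auto
  moreover have "And \<beta>1 \<beta>2 \<in> B"
    by (rule assms(2), rule derives_taut2[OF \<beta>(1,3)[THEN derives.prem]]) auto
  ultimately show ?case by blast
qed

definition consistent :: "('p, 'v) fm set \<Rightarrow> bool" where
  "consistent \<Gamma> \<longleftrightarrow> \<not> (\<exists>\<phi>. derives \<Gamma> \<phi> \<and> derives \<Gamma> (Neg \<phi>))"

definition mcs :: "('p, 'v) fm set \<Rightarrow> bool" where
  "mcs w \<longleftrightarrow> consistent w \<and> (\<forall>\<phi>. \<phi> \<in> w \<or> Neg \<phi> \<in> w)"

lemma inconsistent_derives: "\<not> consistent \<Gamma> \<Longrightarrow> derives \<Gamma> \<phi>"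
  unfolding consistent_def by (auto elim: derives_taut2)

lemma consistent_insert_Neg: "\<not> derives \<Gamma> \<phi> \<Longrightarrow> consistent (insert (Neg \<phi>) \<Gamma>)"
proof (rule ccontr)
  assume "\<not> consistent (insert (Neg \<phi>) \<Gamma>)"
  then have "derives \<Gamma> (Imp (Neg \<phi>) \<phi>)" by (intro deduction inconsistent_derives)
  then have "derives \<Gamma> \<phi>" by (rule derives_taut1) auto
  moreover assume "\<not> derives \<Gamma> \<phi>"
  ultimately show False by simp
qed

text \<open>A contradiction uses finitely many premises, and these already lie together in one
  member of the chain.\<close>

lemma consistent_Union_chain:
  assumes C: "subset.chain {\<Delta>. consistent \<Delta> \<and> \<Gamma> \<subseteq> \<Delta>} C" and "C \<noteq> {}"
  shows "consistent (\<Union>C)"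
  unfolding consistent_def
proof safe
  fix \<phi> assume "derives (\<Union>C) \<phi>" "derives (\<Union>C) (Neg \<phi>)"
  then obtain F G where F: "finite F" "F \<subseteq> \<Union>C" "derives F \<phi>"
    and G: "finite G" "G \<subseteq> \<Union>C" "derives G (Neg \<phi>)"
    using derives_finite by meson
  then obtain \<Delta> where "\<Delta> \<in> C" "F \<union> G \<subseteq> \<Delta>"
    using finite_subset_Union_chain[of "F \<union> G" C] C \<open>C \<noteq> {}\<close> by (metis Un_subset_iff finite_UnI)
  then have "derives \<Delta> \<phi>" "derives \<Delta> (Neg \<phi>)" "consistent \<Delta>"
    using F G C by (auto intro: derives_mono simp: subset.chain_def)
  then show False by (auto simp: consistent_def)
qed

lemma lindenbaum:
  assumes "consistent \<Gamma>"
  obtains w where "mcs w" "\<Gamma> \<subseteq> w"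
proof -
  let ?E = "{\<Delta>. consistent \<Delta> \<and> \<Gamma> \<subseteq> \<Delta>}"
  have "\<exists>w\<in>?E. \<forall>\<Delta>\<in>?E. w \<subseteq> \<Delta> \<longrightarrow> \<Delta> = w"
  proof (rule subset_Zorn_nonempty)
    show "\<Union>C \<in> ?E" if "C \<noteq> {}" "subset.chain ?E C" for C
      using that(1) consistent_Union_chain[OF that(2,1)] that(2) by (fastforce simp: subset.chain_def)
  qed (use assms in auto)
  then obtain w where w: "consistent w" "\<Gamma> \<subseteq> w" and "\<forall>\<Delta>\<in>?E. w \<subseteq> \<Delta> \<longrightarrow> \<Delta> = w"
    by blast
  then have max: "\<Delta> = w" if "consistent \<Delta>" "w \<subseteq> \<Delta>" for \<Delta>
    using that by (metis (no_types, lifting) mem_Collect_eq subset_trans)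
  have "\<phi> \<in> w \<or> Neg \<phi> \<in> w" for \<phi>
  proof (cases "derives w \<phi>")
    case False
    then show ?thesis using max[OF consistent_insert_Neg] by blast
  next
    case True
    \<comment> \<open>Adding a derivable formula yields no new consequences, so maximality puts
      \<phi> into \<open>w\<close>.\<close>
    have "consistent (insert \<phi> w)"
      unfolding consistent_def
    proof safe
      fix \<psi> assume "derives (insert \<phi> w) \<psi>" "derives (insert \<phi> w) (Neg \<psi>)"
      then have "derives w \<psi>" "derives w (Neg \<psi>)"
        using True derives.mp deduction by blast+
      then show False using w(1) by (auto simp: consistent_def)
    qed
    then show ?thesis using max by blast
  qed
  with w that show thesis by (auto simp: mcs_def)
qed

section \<open>Membership in maximal consistent sets\<close>

lemma mcs_derives: "mcs w \<Longrightarrow> derives w \<phi> \<longleftrightarrow> \<phi> \<in> w"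
  unfolding mcs_def consistent_def by (blast intro: derives.prem)

lemma mcs_thm: "mcs w \<Longrightarrow> dwplc \<phi> \<Longrightarrow> \<phi> \<in> w"
  by (metis mcs_derives derives.provable)

lemma mcs_mp: "mcs w \<Longrightarrow> dwplc (Imp \<phi> \<psi>) \<Longrightarrow> \<phi> \<in> w \<Longrightarrow> \<psi> \<in> w"
  by (metis mcs_derives derives.provable derives.mp)

lemma mcs_axiom: "mcs w \<Longrightarrow> wplc_axiom (Imp \<phi> \<psi>) \<Longrightarrow> \<phi> \<in> w \<Longrightarrow> \<psi> \<in> w"
  by (metis mcs_mp dwplc.WPLC)

lemma mcs_Neg: "mcs w \<Longrightarrow> Neg \<phi> \<in> w \<longleftrightarrow> \<phi> \<notin> w"
  unfolding mcs_def consistent_def by (blast intro: derives.prem)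

lemma mcs_And:
  assumes "mcs w"
  shows "And \<phi> \<psi> \<in> w \<longleftrightarrow> \<phi> \<in> w \<and> \<psi> \<in> w"
proof (intro iffI conjI)
  assume "And \<phi> \<psi> \<in> w"
  then have *: "derives w (And \<phi> \<psi>)" by (rule derives.prem)
  show "\<phi> \<in> w" "\<psi> \<in> w"
    using derives_taut1[OF *] assms by (auto simp flip: mcs_derives[OF assms])
next
  assume "\<phi> \<in> w \<and> \<psi> \<in> w"
  then have "derives w (And \<phi> \<psi>)"
    by (auto intro!: derives_taut2[OF derives.prem derives.prem, of \<phi> w \<psi>])
  then show "And \<phi> \<psi> \<in> w" using assms mcs_derives by blast
qed

lemma mcs_BigOr: "mcs w \<Longrightarrow> BigOr \<phi> \<phi>s \<in> w \<longleftrightarrow> (\<exists>\<psi>\<in>set (\<phi> # \<phi>s). \<psi> \<in> w)"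
  by (induction \<phi> \<phi>s rule: BigOr.induct) (auto simp: Or_def mcs_Neg mcs_And)

text \<open>This is the output that a classifier will be given at the world \<open>w\<close>.
  Existence comes from \<open>AtLeast\<close>, uniqueness from \<open>AtMost\<close>.\<close>

lemma mcs_ex1_Dec:
  fixes w :: "('p, 'v::finite) fm set"
  assumes "mcs w"
  shows "\<exists>!x. Dec x \<in> w"
proof -
  obtain xs where "set xs = (UNIV :: 'v set)" "distinct xs"
    using finite_distinct_list[OF finite_UNIV] by blast
  then obtain y ys where "distinct (y # ys)" "set (y # ys) = (UNIV :: 'v set)"
    by (cases xs) auto
  then have "BigOr (Dec y) (map Dec ys) \<in> w"
    by (intro mcs_thm[OF assms] dwplc.WPLC wplc_axiom.AtLeast)
  then have "\<exists>x. Dec x \<in> w" by (auto simp: mcs_BigOr[OF assms])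
  moreover have "x = y" if "Dec x \<in> w" "Dec y \<in> w" for x y
    using mcs_axiom[OF assms wplc_axiom.AtMost that(1)] that(2) mcs_Neg[OF assms] by blast
  ultimately show ?thesis by blast
qed

section \<open>The canonical relations\<close>

definition acc :: "(('p, 'v) fm \<Rightarrow> ('p, 'v) fm) \<Rightarrow> ('p, 'v) fm set \<Rightarrow> ('p, 'v) fm set \<Rightarrow> bool" where
  "acc B w u \<longleftrightarrow> (\<forall>\<phi>. B \<phi> \<in> w \<longrightarrow> \<phi> \<in> u)"

context
  fixes B :: "('p, 'v) fm \<Rightarrow> ('p, 'v) fm"
  assumes B: "B \<in> {BoxI, BoxF}"
begin

lemma acc_refl: "mcs w \<Longrightarrow> acc B w w"
  using mcs_axiom[OF _ wplc_axiom.T[OF B]] by (auto simp: acc_def)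

lemma acc_trans: "mcs u \<Longrightarrow> acc B u v \<Longrightarrow> acc B v w \<Longrightarrow> acc B u w"
  using mcs_axiom[OF _ wplc_axiom.Four[OF B]] by (auto simp: acc_def)

text \<open>If \<open>B \<phi>\<close> is in \<open>u\<close> but \<phi> is not in \<open>w\<close>,
  then T puts \<open>Neg (B \<phi>)\<close> into \<open>w\<close>, and 5 carries it over to
  \<open>u\<close>, a contradiction.\<close>

lemma acc_sym: "mcs w \<Longrightarrow> mcs u \<Longrightarrow> acc B w u \<Longrightarrow> acc B u w"
  unfolding acc_def
  by (metis mcs_axiom wplc_axiom.T[OF B] wplc_axiom.Five[OF B] mcs_Neg)

text \<open>Nec and K lift a whole derivation under the box, which gives the existence of accessible
  worlds refuting a formula.\<close>

lemma derives_Box: "derives {\<phi>. B \<phi> \<in> w} \<psi> \<Longrightarrow> derives w (B \<psi>)"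
proof (induction rule: derives.induct)
  case (prem \<phi>)
  then show ?case by (auto intro: derives.prem)
next
  case (provable \<phi>)
  then show ?case using B by (auto intro: derives.provable dwplc.Nec)
next
  case (mp \<phi> \<psi>)
  have "derives w (And (B \<phi>) (B (Imp \<phi> \<psi>)))"
    by (rule derives_taut2[OF mp.IH]) auto
  then show ?case
    by (rule derives.mp[OF derives.provable[OF dwplc.WPLC[OF wplc_axiom.K[OF B]]]])
qed

lemma Box_mono:
  assumes "mcs w" "dwplc (Imp \<phi> \<psi>)" "B \<phi> \<in> w"
  shows "B \<psi> \<in> w"
proof -
  have "derives {\<phi>. B \<phi> \<in> w} \<psi>"
    by (rule derives.mp[OF derives.provable[OF assms(2)] derives.prem]) (simp add: assms(3))
  then show ?thesis using derives_Box mcs_derives assms(1) by blast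
qed

lemma mcs_Box_iff:
  assumes "mcs w"
  shows "B \<phi> \<in> w \<longleftrightarrow> (\<forall>u. mcs u \<and> acc B w u \<longrightarrow> \<phi> \<in> u)"
proof
  assume *: "\<forall>u. mcs u \<and> acc B w u \<longrightarrow> \<phi> \<in> u"
  show "B \<phi> \<in> w"
  proof (rule ccontr)
    assume "B \<phi> \<notin> w"
    then have "\<not> derives {\<phi>. B \<phi> \<in> w} \<phi>"
      using derives_Box mcs_derives assms by blast
    then obtain u where "mcs u" "insert (Neg \<phi>) {\<phi>. B \<phi> \<in> w} \<subseteq> u"
      using lindenbaum consistent_insert_Neg by metis
    with * show False by (auto simp: acc_def mcs_Neg)
  qed
qed (auto simp: acc_def)

end

text \<open>The frame condition of Comm: a \<open>BoxI\<close> step followed by a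
  \<open>BoxF\<close> step can be taken in the other order. The intermediate world is a maximal
  consistent extension of \<open>?A \<union> ?B\<close>, where \<open>?B\<close> suffices for access
  to \<open>j\<close> because \<open>BoxI\<close> access is symmetric.\<close>

lemma acc_commute:
  fixes i j v :: "('p, 'v) fm set"
  assumes "mcs i" "mcs j" "mcs v" "acc BoxI i v" "acc BoxF v j"
  obtains w where "mcs w" "acc BoxF i w" "acc BoxI w j"
proof -
  let ?A = "{\<phi>. BoxF \<phi> \<in> i}" and ?B = "{\<phi>. BoxI \<phi> \<in> j}"
  have closed: "\<beta> \<in> ?B" if "derives ?B \<beta>" for \<beta>
    using derives_Box[OF _ that] mcs_derives[OF assms(2)] by simp
  have "consistent (?A \<union> ?B)"
  proof (rule ccontr)
    assume "\<not> consistent (?A \<union> ?B)"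
    then have "derives (?A \<union> ?B) (And \<phi> (Neg \<phi>))" for \<phi>
      by (rule inconsistent_derives)
    then obtain \<beta> \<phi> where \<beta>: "BoxI \<beta> \<in> j" "derives ?A (Imp \<beta> (And \<phi> (Neg \<phi>)))"
      using derives_Un_closed closed by blast
    then have "derives ?A (Neg \<beta>)" by (auto elim: derives_taut1)
    then have "BoxF (Neg \<beta>) \<in> i"
      using derives_Box[of BoxF i "Neg \<beta>"] mcs_derives[OF assms(1)] by simp
    \<comment> \<open>T, contraposed, and 5 yield a \<open>BoxI\<close> under the
      \<open>BoxF\<close>. Comm swaps the two boxes, and the path from \<open>i\<close> through
      \<open>v\<close> to \<open>j\<close> then strips them, leaving
      \<open>Neg (BoxI \<beta>)\<close> in \<open>j\<close>.\<close>
    moreover have "dwplc (Imp (Neg \<beta>) (BoxI (Neg (BoxI \<beta>))))"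
      by (rule dwplc_taut2[OF dwplc.WPLC[OF wplc_axiom.T] dwplc.WPLC[OF wplc_axiom.Five],
            of BoxI BoxI \<beta> \<beta>]) auto
    ultimately have "BoxF (BoxI (Neg (BoxI \<beta>))) \<in> i"
      using Box_mono[of BoxF] assms(1) by blast
    moreover have "dwplc (Imp (BoxF (BoxI \<phi>)) (BoxI (BoxF \<phi>)))" for \<phi> :: "('p, 'v) fm"
      by (rule dwplc_taut1[OF dwplc.WPLC[OF wplc_axiom.Comm]]) auto
    ultimately have "BoxI (BoxF (Neg (BoxI \<beta>))) \<in> i"
      using mcs_mp[OF assms(1)] by blast
    then have "Neg (BoxI \<beta>) \<in> j" using assms by (auto simp: acc_def)
    with \<beta>(1) show False using mcs_Neg[OF assms(2)] by blast
  qed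
  then obtain w where w: "mcs w" "?A \<union> ?B \<subseteq> w" using lindenbaum by blast
  moreover have "acc BoxI j w" using w(2) by (auto simp: acc_def)
  ultimately show thesis using that acc_sym[of BoxI j w] assms(2)
    by (auto simp: acc_def)
qed

section \<open>Unravelling a component into a product\<close>

definition cell :: "('p, 'v) fm set \<Rightarrow> ('p, 'v) fm set \<Rightarrow> ('p, 'v) fm set set" where
  "cell i j = {w. mcs w \<and> acc BoxF i w \<and> acc BoxI w j}"

text \<open>The worlds of a cell are themselves sets of formulas, hence elements of the group. The
  map from the group onto a nonempty cell is the identity on the cell and one fixed member of it
  elsewhere.\<close>

fun grid :: "('p, 'v) fm set \<times> ('p, 'v) fm set \<Rightarrow> ('p, 'v) fm set \<times> ('p, 'v) fm set \<Rightarrow> ('p, 'v) fm set"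
  where "grid (i, a) (j, b) = (let c = sym_diff a b in if c \<in> cell i j then c else SOME w. w \<in> cell i j)"

text \<open>Every set is its own inverse under symmetric difference, so either coordinate can be
  solved for.\<close>

lemma sym_diff_cancel: "sym_diff a (sym_diff a b) = b" "sym_diff (sym_diff a b) b = a"
  by auto

locale component =
  fixes r :: "('p, 'v) fm set"
  assumes root: "mcs r"
begin

definition rows :: "(('p, 'v) fm set \<times> ('p, 'v) fm set) set" where
  "rows = {i. mcs i \<and> acc BoxI i r} \<times> UNIV"

definition cols :: "(('p, 'v) fm set \<times> ('p, 'v) fm set) set" where
  "cols = {j. mcs j \<and> acc BoxF r j} \<times> UNIV"

text \<open>The path from \<open>i\<close> by \<open>BoxI\<close> to \<open>r\<close> and by
  \<open>BoxF\<close> to \<open>j\<close> commutes, so the cell is nonempty and the default choice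
  in \<open>grid\<close> lies in it.\<close>

lemma grid_in_cell:
  assumes "x \<in> rows" "y \<in> cols"
  shows "grid x y \<in> cell (fst x) (fst y)"
proof -
  obtain i a j b where xy: "x = (i, a)" "y = (j, b)" by fastforce
  then have "\<exists>w. w \<in> cell i j"
    using assms root acc_commute[of i j r] by (auto simp: rows_def cols_def cell_def)
  then show ?thesis by (auto simp: xy Let_def intro: someI_ex)
qed

lemma mcs_grid: "x \<in> rows \<Longrightarrow> y \<in> cols \<Longrightarrow> mcs (grid x y)"
  using grid_in_cell by (auto simp: cell_def)

lemma root_in_grid: "(r, r) \<in> rows" "(r, {}) \<in> cols" "grid (r, r) (r, {}) = r"
  using root by (auto simp: rows_def cols_def cell_def acc_refl Let_def)

text \<open>All worlds of a column access its \<open>j\<close> by \<open>BoxI\<close>, hence each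
  other. Conversely, every world accessible from the column occurs in it, at a suitable row.\<close>

lemma grid_BoxI:
  assumes "x \<in> rows" "y \<in> cols"
  shows "BoxI \<phi> \<in> grid x y \<longleftrightarrow> (\<forall>x'\<in>rows. \<phi> \<in> grid x' y)"
proof safe
  fix i a assume *: "BoxI \<phi> \<in> grid x y" "(i, a) \<in> rows"
  have "acc BoxI (grid x y) (fst y)" "acc BoxI (fst y) (grid (i, a) y)"
    using grid_in_cell[OF assms] grid_in_cell[OF *(2) assms(2)] assms(2)
    by (auto simp: cell_def cols_def intro: acc_sym)
  then have "acc BoxI (grid x y) (grid (i, a) y)"
    using acc_trans mcs_grid assms by blast
  with * show "\<phi> \<in> grid (i, a) y" by (auto simp: acc_def)
next
  assume *: "\<forall>x'\<in>rows. \<phi> \<in> grid x' y"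
  obtain j b where y: "y = (j, b)" by fastforce
  with assms(2) have j: "mcs j" "acc BoxF j r"
    using acc_sym[of BoxF r j] root by (auto simp: cols_def)
  have "\<phi> \<in> u" if u: "mcs u" "acc BoxI (grid x y) u" for u
  proof -
    have "acc BoxI (grid x y) j"
      using grid_in_cell[OF assms] by (simp add: y cell_def)
    then have uj: "acc BoxI u j"
      using u mcs_grid[OF assms] acc_sym[of BoxI "grid x y" u] acc_trans[of BoxI u "grid x y" j]
      by auto
    \<comment> \<open>The path from \<open>u\<close> by \<open>BoxI\<close> to \<open>j\<close> and
      by \<open>BoxF\<close> to \<open>r\<close> is commuted; its new midpoint labels the row in
      which \<open>u\<close> lies.\<close>
    then obtain i where i: "mcs i" "acc BoxF u i" "acc BoxI i r"
      using acc_commute[OF u(1) root j(1) _ j(2)] by blast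
    then have "u \<in> cell i j"
      using u uj acc_sym[of BoxF u i] by (auto simp: cell_def)
    \<comment> \<open>The second component of the row is chosen so that its symmetric difference
      with \<open>b\<close> is \<open>u\<close> itself.\<close>
    then have "grid (i, sym_diff u b) y = u"
      by (simp add: y sym_diff_cancel)
    moreover have "(i, sym_diff u b) \<in> rows" using i by (simp add: rows_def)
    ultimately show ?thesis using * by metis
  qed
  then show "BoxI \<phi> \<in> grid x y" using mcs_Box_iff[of BoxI] mcs_grid assms by blast
qed

lemma grid_BoxF:
  assumes "x \<in> rows" "y \<in> cols"
  shows "BoxF \<phi> \<in> grid x y \<longleftrightarrow> (\<forall>y'\<in>cols. \<phi> \<in> grid x y')"
proof safe
  fix j b assume *: "BoxF \<phi> \<in> grid x y" "(j, b) \<in> cols"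
  have "acc BoxF (grid x y) (fst x)" "acc BoxF (fst x) (grid x (j, b))"
    using grid_in_cell[OF assms] grid_in_cell[OF assms(1) *(2)] assms(1)
    by (auto simp: cell_def rows_def intro: acc_sym)
  then have "acc BoxF (grid x y) (grid x (j, b))"
    using acc_trans mcs_grid assms by blast
  with * show "\<phi> \<in> grid x (j, b)" by (auto simp: acc_def)
next
  assume *: "\<forall>y'\<in>cols. \<phi> \<in> grid x y'"
  obtain i a where x: "x = (i, a)" by fastforce
  with assms(1) have i: "mcs i" "acc BoxI r i"
    using acc_sym[of BoxI i r] root by (auto simp: rows_def)
  have "\<phi> \<in> u" if u: "mcs u" "acc BoxF (grid x y) u" for u
  proof -
    have "acc BoxF i (grid x y)"
      using grid_in_cell[OF assms] by (simp add: x cell_def)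
    then have iu: "acc BoxF i u"
      using u i acc_trans[of BoxF i "grid x y" u] by auto
    \<comment> \<open>Here the path from \<open>r\<close> by \<open>BoxI\<close> to \<open>i\<close>
      and by \<open>BoxF\<close> to \<open>u\<close> is commuted, and the midpoint labels a
      column.\<close>
    then obtain j where j: "mcs j" "acc BoxF r j" "acc BoxI j u"
      using acc_commute[OF root u(1) i(1) i(2)] by blast
    then have "u \<in> cell i j"
      using u iu acc_sym[of BoxI j u] by (auto simp: cell_def)
    then have "grid x (j, sym_diff a u) = u"
      by (simp add: x sym_diff_cancel)
    moreover have "(j, sym_diff a u) \<in> cols" using j by (simp add: cols_def)
    ultimately show ?thesis using * by metis
  qed
  then show "BoxF \<phi> \<in> grid x y" using mcs_Box_iff[of BoxF] mcs_grid assms by blast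
qed

text \<open>By the Indep axioms atoms do not change along \<open>BoxF\<close>, so a row behaves like
  a single state.\<close>

lemma grid_Atm:
  assumes "x \<in> rows" "y \<in> cols"
  shows "Atm p \<in> grid x y \<longleftrightarrow> Atm p \<in> fst x"
proof -
  have "mcs (fst x)" "mcs (grid x y)" "acc BoxF (fst x) (grid x y)"
    using grid_in_cell[OF assms] assms by (auto simp: cell_def rows_def)
  then show ?thesis
    using mcs_axiom[OF _ wplc_axiom.Indep_pos] mcs_axiom[OF _ wplc_axiom.Indep_neg]
    by (metis acc_def mcs_Neg)
qed

end

section \<open>Completeness\<close>

instance fm :: (countable, countable) countable
  by countable_datatype

lemma finite_set1_fm: "finite (set1_fm \<phi>)"
  by (induction \<phi>) auto

text \<open>A pair of sets of formulas is a subset of a disjoint sum of two countable types, and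
  \<open>g\<close> embeds that sum into \<open>U\<close>.\<close>

lemma infinite_atoms_code:
  fixes U :: "'p::countable set"
  assumes "infinite U"
  obtains code :: "('p, 'v::finite) fm set \<times> ('p, 'v) fm set \<Rightarrow> 'p set"
  where "inj code" "\<And>x. code x \<subseteq> U"
proof -
  obtain e :: "nat \<Rightarrow> 'p" where e: "inj e" "range e \<subseteq> U"
    using infinite_countable_subset[OF assms] by blast
  define g :: "('p, 'v) fm + ('p, 'v) fm \<Rightarrow> 'p" where "g = e \<circ> to_nat"
  have g: "inj g" unfolding g_def by (rule inj_compose[OF e(1) inj_to_nat])
  have "inj (\<lambda>x. g ` (fst x <+> snd x))"
  proof (rule injI)
    fix x y :: "('p, 'v) fm set \<times> ('p, 'v) fm set"
    assume "g ` (fst x <+> snd x) = g ` (fst y <+> snd y)"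
    then have *: "fst x <+> snd x = fst y <+> snd y" using g by (simp add: inj_image_eq_iff)
    have "Inl -` (A <+> B) = A" "Inr -` (A <+> B) = B"
      for A B :: "('p, 'v) fm set"
      by auto
    with * show "x = y" by (metis prod_eqI)
  qed
  moreover have "g ` X \<subseteq> U" for X using e(2) by (auto simp: g_def)
  ultimately show thesis by (rule that)
qed

lemma static_complete:
  fixes \<phi> :: "('p::countable, 'v::finite) fm"
  assumes inf: "infinite (UNIV :: 'p set)" and "static \<phi>" and valid: "mcm_valid \<phi>"
  shows "dwplc \<phi>"
proof (rule ccontr)
  assume "\<not> dwplc \<phi>"
  then have "consistent {Neg \<phi>}"
    by (intro consistent_insert_Neg) (simp add: derives_empty)
  then obtain r where r: "mcs r" "Neg \<phi> \<in> r" using lindenbaum by blast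
  interpret component r by standard (rule r(1))
  \<comment> \<open>Only atoms of \<phi> must keep their canonical truth value; all others are free
    to encode rows.\<close>
  define A where "A = set1_fm \<phi>"
  have "infinite (- A)"
    using inf finite_set1_fm by (simp add: A_def)
  then obtain code :: "('p, 'v) fm set \<times> ('p, 'v) fm set \<Rightarrow> 'p set"
    where code: "inj code" "\<And>x. code x \<subseteq> - A" by (rule infinite_atoms_code) (rule that)
  define st where "st x = {p \<in> A. Atm p \<in> fst x} \<union> code x" for x
  have "st x \<inter> - A = code x" for x using code(2)[of x] by (auto simp: st_def)
  then have inj_st: "inj st" using code(1) by (metis injI injD)
  define fn where "fn y = (\<lambda>s\<in>st ` rows. THE v. Dec v \<in> grid (inv st s) y)" for y
  have fn: "fn y (st x) = v \<longleftrightarrow> Dec v \<in> grid x y" if "x \<in> rows" "y \<in> cols" for x y v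
  proof -
    have eq: "fn y (st x) = (THE v. Dec v \<in> grid x y)"
      using that by (simp add: fn_def inv_f_f[OF inj_st])
    have ex1: "\<exists>!v. Dec v \<in> grid x y"
      by (rule mcs_ex1_Dec[OF mcs_grid[OF that]])
    have "Dec (fn y (st x)) \<in> grid x y"
      unfolding eq by (rule theI'[OF ex1])
    with ex1 show ?thesis by blast
  qed
  define \<Gamma> where "\<Gamma> = (st ` rows, fn ` cols)"
  \<comment> \<open>The bound on the atoms of \<psi> is essential, since outside \<open>A\<close> a
    state carries its code. Distinct columns may yield the same function; this is harmless, because
    \<open>BoxF\<close> ranges over the image of \<open>cols\<close>.\<close>
  have truth: "sat \<Gamma> (st x) (fn y) \<psi> \<longleftrightarrow> \<psi> \<in> grid x y"
    if "static \<psi>" "set1_fm \<psi> \<subseteq> A" "x \<in> rows" "y \<in> cols" for \<psi> x y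
    using that
  proof (induction \<psi> arbitrary: x y)
    case (Atm p)
    then show ?case using code(2)[of x] by (auto simp: st_def grid_Atm)
  next
    case (Neg \<psi>)
    then show ?case by (simp add: mcs_Neg mcs_grid)
  next
    case (And \<psi> \<chi>)
    then show ?case by (simp add: mcs_And mcs_grid)
  next
    case (BoxI \<psi>)
    then show ?case by (simp add: grid_BoxI) (simp add: \<Gamma>_def)
  next
    case (BoxF \<psi>)
    then show ?case by (simp add: grid_BoxF) (simp add: \<Gamma>_def)
  qed (simp_all add: fn)
  have "is_mcm \<Gamma>"
    by (auto simp: is_mcm_def \<Gamma>_def fn_def)
  then have "sat \<Gamma> (st (r, r)) (fn (r, {})) \<phi>"
    using valid root_in_grid by (auto simp: mcm_valid_def \<Gamma>_def)
  then have "\<phi> \<in> r"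
    using truth[of \<phi> "(r, r)" "(r, {})"] \<open>static \<phi>\<close> root_in_grid by (simp add: A_def)
  with r show False by (simp add: mcs_Neg)
qed

theorem theorem9:
  fixes \<phi> :: "('p::countable, 'v::finite) fm"
  assumes "infinite (UNIV :: 'p set)"
  shows "dwplc \<phi> \<longleftrightarrow> mcm_valid \<phi>"
proof
  assume valid: "mcm_valid \<phi>"
  obtain \<chi> where \<chi>: "static \<chi>" "dwplc (Iff \<phi> \<chi>)"
    using equivalent_static by blast
  \<comment> \<open>Soundness of the provable equivalence transfers validity from \<phi> to its
    static form.\<close>
  from dwplc_sound[OF \<chi>(2)] valid have "mcm_valid \<chi>"
    by (auto simp: mcm_valid_def)
  with \<chi>(1) have "dwplc \<chi>" by (intro static_complete assms)
  from \<chi>(2) this show "dwplc \<phi>" by (rule dwplc_taut2) simp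
qed (rule dwplc_sound)

end
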